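(* Let $0<\epsilon,\delta<1$ and suppose that each of the candidate distributions $\mathcal{C}_1,\dots,\mathcal{C}_K$ satisfies the $(\epsilon,\delta)$-lower deviation inequality. Then the mean-weighted allocation $\mathbf{v}$, given by $v_i=R\mu_i/Z$ for $1\le i\le K$, satisfies $$Q(\mathbf{v},\{\mathcal{C}_i\})\le\epsilon+\delta-\epsilon\delta.$$
   Context: There are $K\ge 1$ groups. For each group $i$, the number of candidates $C_i\ge 0$ is a real-valued random variable with distribution $\mathcal{C}_i$ and finite mean $\mu_i=\mathbb{E}[C_i]>0$; the $C_i$ are independent. Put $Z=\sum_{i=1}^K\mu_i$. There are $R$ units of resource, $R$ a positive integer, which may be allocated fractionally. Availability: $q(v_i,\mathcal{C}_i)=\mathbb{E}[\min(C_i,v_i)]/\mathbb{E}[C_i]$. Fairness: $Q(\mathbf{v},\{\mathcal{C}_i\})=\max_{i,j}|q(v_i,\mathcal{C}_i)-q(v_j,\mathcal{C}_j)|$. A random variable $X$ (or its distribution) satisfies the $(\epsilon,\delta)$-lower deviation inequality if $\Pr[X\le(1-\epsilon)\mathbb{E}[X]]\le\delta$. *)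

theory Defs
  imports "HOL-Probability.Probability"
begin

text \<open>
  The law of a real random variable is a measure on the Borel sets of the reals. Availability,
  fairness and the deviation inequality depend only on laws, so they are defined for them.
\<close>

definition mean :: "real measure \<Rightarrow> real" where
  "mean D = (\<integral>x. x \<partial>D)"

definition availability :: "real \<Rightarrow> real measure \<Rightarrow> real" where
  "availability v D = (\<integral>x. min x v \<partial>D) / mean D"

text \<open>
  The groups are \<open>1, \<dots>, K\<close>; values of \<open>v\<close> and \<open>D\<close> outside this range are ignored.
  The maximum is over a nonempty set only for \<open>K \<ge> 1\<close>.
\<close>

definition fairness :: "nat \<Rightarrow> (nat \<Rightarrow> real) \<Rightarrow> (nat \<Rightarrow> real measure) \<Rightarrow> real" where
  "fairness K v D =
     Max ((\<lambda>(i, j). \<bar>availability (v i) (D i) - availability (v j) (D j)\<bar>) ` ({1..K} \<times> {1..K}))"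

definition lower_deviation :: "real \<Rightarrow> real \<Rightarrow> real measure \<Rightarrow> bool" where
  "lower_deviation \<epsilon> \<delta> D \<longleftrightarrow> measure D {x \<in> space D. x \<le> (1 - \<epsilon>) * mean D} \<le> \<delta>"

definition mean_weighted_allocation :: "nat \<Rightarrow> nat \<Rightarrow> (nat \<Rightarrow> real) \<Rightarrow> nat \<Rightarrow> real" where
  "mean_weighted_allocation K R \<mu> i = real R * \<mu> i / (\<Sum>j = 1..K. \<mu> j)"

end

theory Submission
  imports Defs
begin

text \<open>
  Let \<open>r = R / Z\<close>, so that the allocation is \<open>v i = r * \<mu> i\<close>. The availability of group \<open>i\<close> is then the
  expectation of \<open>min X r\<close>, where \<open>X = C i / \<mu> i\<close> has mean 1. By Jensen it is at most
  \<open>min 1 r\<close>, and since \<open>X > 1 - \<epsilon>\<close> with probability at least \<open>1 - \<delta>\<close>, it is at least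
  \<open>(1 - \<epsilon>) * (1 - \<delta>) * min 1 r\<close>. So all availabilities lie in a common interval of length at most
  \<open>1 - (1 - \<epsilon>) * (1 - \<delta>) = \<epsilon> + \<delta> - \<epsilon> * \<delta>\<close>.
\<close>

text \<open>The concave function involved is a truncation, so Jensen reduces to integrating two
  pointwise bounds: \<open>min x v\<close> lies below \<open>x\<close> and below the constant
  \<open>v\<close>.\<close>

lemma availability_upper_bound:
  assumes "prob_space D" and "integrable D (\<lambda>x. x)" and "0 < mean D"
  shows "availability (r * mean D) D \<le> min 1 r"
proof -
  interpret prob_space D by fact
  have int: "integrable D (\<lambda>x. min x (r * mean D))"
    using assms(2) by simp
  have "(\<integral>x. min x (r * mean D) \<partial>D) \<le> (\<integral>x. x \<partial>D)"
    by (intro integral_mono int assms(2)) auto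
  moreover have "(\<integral>x. min x (r * mean D) \<partial>D) \<le> (\<integral>x. r * mean D \<partial>D)"
    by (intro integral_mono int) auto
  ultimately show ?thesis
    using \<open>0 < mean D\<close> by (simp add: availability_def mean_def prob_space divide_le_eq)
qed

text \<open>A Markov-type argument: the truncation dominates \<open>c\<close> times the indicator of
  the event \<open>A\<close> that no large downward deviation occurs.\<close>

lemma availability_lower_bound:
  assumes "prob_space D" and "integrable D (\<lambda>x. x)" and "0 < mean D"
    and nonneg: "AE x in D. 0 \<le> x" and dev: "lower_deviation \<epsilon> \<delta> D"
    and "0 \<le> \<epsilon>" and "\<epsilon> \<le> 1" and "0 \<le> r"
  shows "(1 - \<epsilon>) * (1 - \<delta>) * min 1 r \<le> availability (r * mean D) D"
proof -
  interpret prob_space D by fact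
  \<comment> \<open>\<open>c\<close> lies below both \<open>(1 - \<epsilon>) * mean D\<close> and
    the cap \<open>r * mean D\<close>; keeping the factor \<open>1 - \<epsilon>\<close> in both
    cases makes the bound a multiple of \<open>min 1 r\<close>.\<close>
  define c where "c = (1 - \<epsilon>) * min 1 r * mean D"
  define A where "A = {x \<in> space D. (1 - \<epsilon>) * mean D < x}"
  have c: "0 \<le> c" "c \<le> (1 - \<epsilon>) * mean D" "c \<le> r * mean D"
  proof -
    show "0 \<le> c"
      using assms by (simp add: c_def)
    have "(1 - \<epsilon>) * min 1 r \<le> (1 - \<epsilon>) * 1"
      using assms by (intro mult_left_mono) auto
    then show "c \<le> (1 - \<epsilon>) * mean D"
      unfolding c_def using \<open>0 < mean D\<close> by (intro mult_right_mono) auto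
    have "(1 - \<epsilon>) * min 1 r \<le> 1 * r"
      using assms by (intro mult_mono) auto
    then show "c \<le> r * mean D"
      unfolding c_def using \<open>0 < mean D\<close> by (intro mult_right_mono) auto
  qed
  have [measurable]: "(\<lambda>x. x) \<in> borel_measurable D"
    using assms(2) by (rule borel_measurable_integrable)
  have A: "A \<in> sets D"
    unfolding A_def by measurable
  \<comment> \<open>The strict inequality in \<open>A\<close> makes it the exact complement of the
    event in \<open>lower_deviation\<close>.\<close>
  have "A = space D - {x \<in> space D. x \<le> (1 - \<epsilon>) * mean D}"
    by (auto simp: A_def)
  then have "1 - \<delta> \<le> prob A"
    using dev by (simp add: lower_deviation_def prob_compl)
  then have "c * (1 - \<delta>) \<le> c * prob A"
    using c(1) by (rule mult_left_mono)
  also have "\<dots> = (\<integral>x. c * indicator A x \<partial>D)"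
    using A by simp
  also have "\<dots> \<le> (\<integral>x. min x (r * mean D) \<partial>D)"
  proof (rule integral_mono_AE)
    \<comment> \<open>On \<open>A\<close> both arguments of \<open>min\<close> are at least
      \<open>c\<close>; off \<open>A\<close> the left side vanishes and both arguments are
      nonnegative.\<close>
    show "AE x in D. c * indicator A x \<le> min x (r * mean D)"
      using nonneg
    proof eventually_elim
      case (elim x)
      then show ?case
        using c \<open>0 \<le> r\<close> \<open>0 < mean D\<close> by (auto simp: A_def indicator_def)
    qed
  qed (use A assms(2) in \<open>simp_all add: integrable_real_indicator less_top[symmetric]\<close>)
  finally show ?thesis
    using \<open>0 < mean D\<close> by (simp add: availability_def c_def le_divide_eq mult_ac)
qed

theorem lemma5:
  fixes M :: "'w measure" and C :: "nat \<Rightarrow> 'w \<Rightarrow> real" and D :: "nat \<Rightarrow> real measure"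
    and \<mu> :: "nat \<Rightarrow> real" and K R :: nat and \<epsilon> \<delta> :: real
  assumes "prob_space M"
    and "K \<ge> 1" and "R \<ge> 1"
    and "prob_space.indep_vars M (\<lambda>_. borel) C {1..K}"
    and "\<And>i. i \<in> {1..K} \<Longrightarrow> D i = distr M borel (C i)"
    and "\<And>i. i \<in> {1..K} \<Longrightarrow> AE x in M. 0 \<le> C i x"
    and "\<And>i. i \<in> {1..K} \<Longrightarrow> integrable M (C i)"
    and "\<And>i. i \<in> {1..K} \<Longrightarrow> \<mu> i = prob_space.expectation M (C i)"
    and "\<And>i. i \<in> {1..K} \<Longrightarrow> 0 < \<mu> i"
    and "0 < \<epsilon>" and "\<epsilon> < 1" and "0 < \<delta>" and "\<delta> < 1"
    and "\<And>i. i \<in> {1..K} \<Longrightarrow> lower_deviation \<epsilon> \<delta> (D i)"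
  shows "fairness K (mean_weighted_allocation K R \<mu>) D \<le> \<epsilon> + \<delta> - \<epsilon> * \<delta>"
proof -
  define r where "r = real R / (\<Sum>j = 1..K. \<mu> j)"
  \<comment> \<open>The factor \<open>r\<close> is common to all groups, so the bounds on
    availability do not depend on \<open>i\<close>.\<close>
  have alloc: "mean_weighted_allocation K R \<mu> i = r * \<mu> i" for i
    by (simp add: mean_weighted_allocation_def r_def)
  have "0 \<le> r"
    unfolding r_def using assms(9) by (intro divide_nonneg_nonneg sum_nonneg) (auto intro: less_imp_le)
  have bounds: "(1 - \<epsilon>) * (1 - \<delta>) * min 1 r \<le> availability (r * \<mu> i) (D i)"
    "availability (r * \<mu> i) (D i) \<le> min 1 r" if i: "i \<in> {1..K}" for i
  proof -
    have [measurable]: "C i \<in> borel_measurable M"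
      using assms(7)[OF i] by (rule borel_measurable_integrable)
    have D: "D i = distr M borel (C i)"
      using assms(5)[OF i] .
    have prob: "prob_space (D i)"
      unfolding D using assms(1) by (rule prob_space.prob_space_distr) measurable
    have int: "integrable (D i) (\<lambda>x. x)"
      unfolding D using assms(7)[OF i] by (simp add: integrable_distr_eq)
    have mean: "mean (D i) = \<mu> i"
      unfolding D mean_def using assms(8)[OF i] by (simp add: integral_distr)
    have nonneg: "AE x in D i. 0 \<le> x"
      unfolding D using assms(6)[OF i] by (simp add: AE_distr_iff)
    have pos: "0 < mean (D i)"
      using mean assms(9)[OF i] by simp
    show "(1 - \<epsilon>) * (1 - \<delta>) * min 1 r \<le> availability (r * \<mu> i) (D i)"
      using availability_lower_bound[OF prob int pos nonneg assms(14)[OF i] _ _ \<open>0 \<le> r\<close>] mean assms(10,11)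
      by simp
    show "availability (r * \<mu> i) (D i) \<le> min 1 r"
      using availability_upper_bound[OF prob int pos, of r] mean by simp
  qed
  \<comment> \<open>The common interval has length
    \<open>1 - (1 - \<epsilon>) * (1 - \<delta>)\<close> times \<open>min 1 r\<close>, and the
    latter factor is at most 1.\<close>
  have "(1 - (1 - \<epsilon>) * (1 - \<delta>)) * min 1 r \<le> (1 - (1 - \<epsilon>) * (1 - \<delta>)) * 1"
    using assms(10-13) by (intro mult_left_mono) (auto simp: mult_le_one)
  then have width: "min 1 r - (1 - \<epsilon>) * (1 - \<delta>) * min 1 r \<le> \<epsilon> + \<delta> - \<epsilon> * \<delta>"
    by (simp add: algebra_simps)
  have "\<bar>availability (r * \<mu> i) (D i) - availability (r * \<mu> j) (D j)\<bar> \<le> \<epsilon> + \<delta> - \<epsilon> * \<delta>"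
    if "i \<in> {1..K}" "j \<in> {1..K}" for i j
    using bounds[OF that(1)] bounds[OF that(2)] width by linarith
  \<comment> \<open>\<open>K \<ge> 1\<close> makes the set under \<open>Max\<close> nonempty, so
    bounding each pair suffices.\<close>
  then show ?thesis
    unfolding fairness_def alloc using \<open>K \<ge> 1\<close> by (subst Max_le_iff) auto
qed

end
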